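(* Let $\mathbf{S}:=(\mathbf{FN}_5\{a,b\}/\theta)^1$, where $\mathbf{FN}_5\{a,b\}$ is the free $5$-nilpotent semigroup on the two-element set $\{a,b\}$ and $\theta$ is the congruence on it whose equivalence classes are $\{(ab)^2,(ba)^2\}$, $\{a^2b^2,b^2a^2\}$, and the rest singletons. Then $\mathbf{S}$ is not finitely related.
   Context: For a nonempty set $A$, $\mathbf{A}^+$ is the free semigroup on $A$ (nonempty words over $A$ under concatenation). For an ideal $\mathbf{I}$ of a semigroup $\mathbf{S}$ (a subsemigroup with $si,is\in I$ for all $i\in I$, $s\in S$), the Rees quotient of $\mathbf{S}$ by $\mathbf{I}$ is the quotient of $\mathbf{S}$ by the congruence $(I\times I)\cup\{(s,s)\mid s\in S\}$. The free $d$-nilpotent semigroup $\mathbf{FN}_d A$ is the Rees quotient of $\mathbf{A}^+$ by the ideal of all words of length at least $d$. For a semigroup $\mathbf{N}$, $\mathbf{N}^1$ denotes $\mathbf{N}$ with an adjoined identity element $1$. A semigroup term $t(x_1,\dots,x_n)$ is a (nonempty) word in the alphabet $x_1,\dots,x_n$; monoids are considered here as semigroups, i.e. with multiplication as the only operation. The $n$-ary term functions of $\mathbf{S}$ are the functions $t^{\mathbf{S}}:S^n\to S$ induced by terms $t(x_1,\dots,x_n)$ by evaluation. A function $f:S^n\to S$ preserves a relation $R\subseteq S^k$ if $f(r_1,\dots,r_n)\in R$ (with $f$ applied componentwise) whenever $r_1,\dots,r_n\in R$. $\mathbf{S}$ is finitely related if there are finitely many finitary relations $R_1,\dots,R_m$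 on $S$ such that the finitary term functions of $\mathbf{S}$ are precisely the finitary functions on $S$ that preserve $R_1,\dots,R_m$. *)

theory Defs
  imports "HOL-Algebra.Congruence"
begin

record 'a semigrp = "'a partial_object" +
  mult :: "['a, 'a] \<Rightarrow> 'a" (infixl \<open>\<otimes>\<index>\<close> 70)

definition is_semigroup :: "('a, 'm) semigrp_scheme \<Rightarrow> bool" where
  "is_semigroup S \<longleftrightarrow>
     (\<forall>x\<in>carrier S. \<forall>y\<in>carrier S. x \<otimes>\<^bsub>S\<^esub> y \<in> carrier S) \<and>
     (\<forall>x\<in>carrier S. \<forall>y\<in>carrier S. \<forall>z\<in>carrier S.
        (x \<otimes>\<^bsub>S\<^esub> y) \<otimes>\<^bsub>S\<^esub> z = x \<otimes>\<^bsub>S\<^esub> (y \<otimes>\<^bsub>S\<^esub> z))"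

definition is_congruence :: "('a, 'm) semigrp_scheme \<Rightarrow> ('a \<times> 'a) set \<Rightarrow> bool" where
  "is_congruence S r \<longleftrightarrow> equiv (carrier S) r \<and>
     (\<forall>(x, x') \<in> r. \<forall>(y, y') \<in> r. (x \<otimes>\<^bsub>S\<^esub> y, x' \<otimes>\<^bsub>S\<^esub> y') \<in> r)"

definition is_ideal :: "('a, 'm) semigrp_scheme \<Rightarrow> 'a set \<Rightarrow> bool" where
  "is_ideal S I \<longleftrightarrow> I \<subseteq> carrier S \<and>
     (\<forall>i\<in>I. \<forall>s\<in>carrier S. s \<otimes>\<^bsub>S\<^esub> i \<in> I \<and> i \<otimes>\<^bsub>S\<^esub> s \<in> I)"

text \<open>The union is over representatives; if \<open>r\<close> is a congruence, all its members coincide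
  (see \<open>quotient_mult\<close> below).\<close>

definition quotient_semigroup ::
    "('a, 'm) semigrp_scheme \<Rightarrow> ('a \<times> 'a) set \<Rightarrow> 'a set semigrp" where
  "quotient_semigroup S r =
     \<lparr>carrier = carrier S // r,
      mult = (\<lambda>X Y. \<Union>x\<in>X. \<Union>y\<in>Y. r `` {x \<otimes>\<^bsub>S\<^esub> y})\<rparr>"

definition rees_congruence :: "('a, 'm) semigrp_scheme \<Rightarrow> 'a set \<Rightarrow> ('a \<times> 'a) set" where
  "rees_congruence S I = I \<times> I \<union> {(s, s) | s. s \<in> carrier S}"

definition rees_quotient :: "('a, 'm) semigrp_scheme \<Rightarrow> 'a set \<Rightarrow> 'a set semigrp" where
  "rees_quotient S I = quotient_semigroup S (rees_congruence S I)"

text \<open>The new identity \<open>None\<close> is adjoined even if \<open>N\<close> already has an identity.\<close>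

definition adjoin_identity :: "('a, 'm) semigrp_scheme \<Rightarrow> 'a option semigrp" where
  "adjoin_identity N =
     \<lparr>carrier = insert None (Some ` carrier N),
      mult = (\<lambda>x y. case x of None \<Rightarrow> y
                | Some u \<Rightarrow> (case y of None \<Rightarrow> x | Some v \<Rightarrow> Some (u \<otimes>\<^bsub>N\<^esub> v)))\<rparr>"

definition free_semigroup :: "'a set \<Rightarrow> 'a list semigrp" where
  "free_semigroup A = \<lparr>carrier = {w \<in> lists A. w \<noteq> []}, mult = (@)\<rparr>"

definition long_words :: "nat \<Rightarrow> 'a set \<Rightarrow> 'a list set" where
  "long_words d A = {w \<in> carrier (free_semigroup A). d \<le> length w}"

definition free_nilpotent :: "nat \<Rightarrow> 'a set \<Rightarrow> 'a list set semigrp" where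
  "free_nilpotent d A = rees_quotient (free_semigroup A) (long_words d A)"

text \<open>The element of the free \<open>d\<close>-nilpotent semigroup represented by the word \<open>w\<close>.\<close>

definition word_class :: "nat \<Rightarrow> 'a set \<Rightarrow> 'a list \<Rightarrow> 'a list set" where
  "word_class d A w = rees_congruence (free_semigroup A) (long_words d A) `` {w}"

text \<open>The power \<open>S\<^sup>n\<close> is the set \<open>{..<n} \<rightarrow>\<^sub>E carrier S\<close> of extensional functions (so variables
  are numbered from \<open>0\<close>), and an \<open>n\<close>-ary function on \<open>S\<close> is an extensional function on
  that set. Hence equality of functions is pointwise equality on \<open>S\<^sup>n\<close>.\<close>

definition finitary_functions :: "'a set \<Rightarrow> nat \<Rightarrow> ((nat \<Rightarrow> 'a) \<Rightarrow> 'a) set" where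
  "finitary_functions B n = ({..<n} \<rightarrow>\<^sub>E B) \<rightarrow>\<^sub>E B"

fun term_value :: "('a, 'm) semigrp_scheme \<Rightarrow> (nat \<Rightarrow> 'a) \<Rightarrow> nat list \<Rightarrow> 'a" where
  "term_value S x [] = undefined"
| "term_value S x [i] = x i"
| "term_value S x (i # j # t) = x i \<otimes>\<^bsub>S\<^esub> term_value S x (j # t)"

definition term_functions :: "('a, 'm) semigrp_scheme \<Rightarrow> nat \<Rightarrow> ((nat \<Rightarrow> 'a) \<Rightarrow> 'a) set" where
  "term_functions S n =
     {(\<lambda>x \<in> {..<n} \<rightarrow>\<^sub>E carrier S. term_value S x t) | t. t \<in> carrier (free_semigroup {..<n})}"

text \<open>Here \<open>r 0, \<dots>, r (n - 1)\<close> are \<open>k\<close>-tuples, and \<open>f\<close> is applied componentwise to them.\<close>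

definition preserves :: "nat \<Rightarrow> ((nat \<Rightarrow> 'a) \<Rightarrow> 'a) \<Rightarrow> nat \<Rightarrow> (nat \<Rightarrow> 'a) set \<Rightarrow> bool" where
  "preserves n f k R \<longleftrightarrow>
     (\<forall>r. (\<forall>j<n. r j \<in> R) \<longrightarrow> (\<lambda>i\<in>{..<k}. f (\<lambda>j\<in>{..<n}. r j i)) \<in> R)"

text \<open>A relation is given together with its arity. Arities of functions and relations are
  positive; there is no nullary semigroup term.\<close>

definition finitely_related :: "('a, 'm) semigrp_scheme \<Rightarrow> bool" where
  "finitely_related S \<longleftrightarrow>
     (\<exists>\<R> :: (nat \<times> (nat \<Rightarrow> 'a) set) set. finite \<R> \<and>
        (\<forall>(k, R) \<in> \<R>. 1 \<le> k \<and> R \<subseteq> ({..<k} \<rightarrow>\<^sub>E carrier S)) \<and>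
        (\<forall>n\<ge>1. term_functions S n =
           {f \<in> finitary_functions (carrier S) n. \<forall>(k, R) \<in> \<R>. preserves n f k R}))"

text \<open>The pairs \<open>{(ab)\<^sup>2, (ba)\<^sup>2}\<close> and \<open>{a\<^sup>2b\<^sup>2, b\<^sup>2a\<^sup>2}\<close>, and the equivalence relation whose
  classes are these two and singletons (see \<open>theta_classes\<close> and \<open>is_congruence_theta\<close>).\<close>

definition theta_class1 :: "'a \<Rightarrow> 'a \<Rightarrow> 'a list set set" where
  "theta_class1 a b = {word_class 5 {a, b} [a, b, a, b], word_class 5 {a, b} [b, a, b, a]}"

definition theta_class2 :: "'a \<Rightarrow> 'a \<Rightarrow> 'a list set set" where
  "theta_class2 a b = {word_class 5 {a, b} [a, a, b, b], word_class 5 {a, b} [b, b, a, a]}"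

definition theta :: "'a \<Rightarrow> 'a \<Rightarrow> ('a list set \<times> 'a list set) set" where
  "theta a b = theta_class1 a b \<times> theta_class1 a b \<union> theta_class2 a b \<times> theta_class2 a b
     \<union> {(s, s) | s. s \<in> carrier (free_nilpotent 5 {a, b})}"

lemma quotient_mult:
  assumes "is_congruence S r" "x \<in> carrier S" "y \<in> carrier S"
  shows "(r `` {x}) \<otimes>\<^bsub>quotient_semigroup S r\<^esub> (r `` {y}) = r `` {x \<otimes>\<^bsub>S\<^esub> y}"
proof -
  have eq: "equiv (carrier S) r"
    and comp: "\<And>u u' v v'. (u, u') \<in> r \<Longrightarrow> (v, v') \<in> r \<Longrightarrow> (u \<otimes>\<^bsub>S\<^esub> v, u' \<otimes>\<^bsub>S\<^esub> v') \<in> r"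
    using assms(1) by (auto simp: is_congruence_def)
  have *: "r `` {u \<otimes>\<^bsub>S\<^esub> v} = r `` {x \<otimes>\<^bsub>S\<^esub> y}" if "u \<in> r `` {x}" "v \<in> r `` {y}" for u v
    using equiv_class_eq[OF eq comp[of x u y v]] that by auto
  have "x \<in> r `` {x}" "y \<in> r `` {y}"
    using equiv_class_self[OF eq] assms by auto
  then have ne: "r `` {x} \<noteq> {}" "r `` {y} \<noteq> {}"
    by blast+
  have "(\<Union>u\<in>r `` {x}. \<Union>v\<in>r `` {y}. r `` {u \<otimes>\<^bsub>S\<^esub> v}) =
      (\<Union>u\<in>r `` {x}. \<Union>v\<in>r `` {y}. r `` {x \<otimes>\<^bsub>S\<^esub> y})"
    by (intro SUP_cong refl) (rule *)
  also have "\<dots> = r `` {x \<otimes>\<^bsub>S\<^esub> y}"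
    by (simp only: UN_constant ne if_False simp_thms)
  finally show ?thesis
    by (simp only: quotient_semigroup_def semigrp.simps)
qed

lemma is_semigroup_quotient:
  assumes S: "is_semigroup S" and r: "is_congruence S r"
  shows "is_semigroup (quotient_semigroup S r)"
proof -
  have c: "carrier (quotient_semigroup S r) = (\<lambda>x. r `` {x}) ` carrier S"
    by (auto simp: quotient_semigroup_def quotient_def)
  have cl: "x \<otimes>\<^bsub>S\<^esub> y \<in> carrier S"
    and assoc: "z \<in> carrier S \<Longrightarrow> (x \<otimes>\<^bsub>S\<^esub> y) \<otimes>\<^bsub>S\<^esub> z = x \<otimes>\<^bsub>S\<^esub> (y \<otimes>\<^bsub>S\<^esub> z)"
    if "x \<in> carrier S" "y \<in> carrier S" for x y z
    using S that by (simp_all add: is_semigroup_def)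
  show ?thesis
    unfolding is_semigroup_def c ball_simps
    by (intro conjI ballI; simp only: quotient_mult[OF r] cl assoc)
       (intro imageI cl)
qed

lemma is_congruence_rees:
  assumes "is_semigroup S" "is_ideal S I"
  shows "is_congruence S (rees_congruence S I)"
proof -
  let ?r = "rees_congruence S I"
  have sub: "I \<subseteq> carrier S"
    and il: "\<And>i s. i \<in> I \<Longrightarrow> s \<in> carrier S \<Longrightarrow> i \<otimes>\<^bsub>S\<^esub> s \<in> I"
    and ir: "\<And>i s. i \<in> I \<Longrightarrow> s \<in> carrier S \<Longrightarrow> s \<otimes>\<^bsub>S\<^esub> i \<in> I"
    and cl: "\<And>x y. x \<in> carrier S \<Longrightarrow> y \<in> carrier S \<Longrightarrow> x \<otimes>\<^bsub>S\<^esub> y \<in> carrier S"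
    using assms by (auto simp: is_semigroup_def is_ideal_def)
  have iff: "(x, y) \<in> ?r \<longleftrightarrow> x \<in> I \<and> y \<in> I \<or> x = y \<and> x \<in> carrier S" for x y
    by (auto simp: rees_congruence_def)
  have "equiv (carrier S) ?r"
  proof (rule equivI)
    show "?r \<subseteq> carrier S \<times> carrier S" using sub by (auto simp: rees_congruence_def)
    show "refl_on (carrier S) ?r" by (auto simp: refl_on_def iff)
    show "sym ?r" by (auto simp: sym_def iff)
    show "trans ?r" by (rule transI) (metis iff)
  qed
  moreover have "(x \<otimes>\<^bsub>S\<^esub> y, x' \<otimes>\<^bsub>S\<^esub> y') \<in> ?r" if "(x, x') \<in> ?r" "(y, y') \<in> ?r" for x x' y y'
    using that unfolding iff by (elim disjE conjE) (simp_all add: il ir cl subsetD[OF sub])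
  ultimately show ?thesis
    unfolding is_congruence_def by blast
qed

lemma is_semigroup_adjoin_identity:
  "is_semigroup N \<Longrightarrow> is_semigroup (adjoin_identity N)"
  by (auto simp: is_semigroup_def adjoin_identity_def)

lemma is_semigroup_free_semigroup: "is_semigroup (free_semigroup A)"
  by (auto simp: is_semigroup_def free_semigroup_def)

lemma is_ideal_long_words: "is_ideal (free_semigroup A) (long_words d A)"
  by (auto simp: is_ideal_def long_words_def free_semigroup_def)

lemma is_semigroup_free_nilpotent: "is_semigroup (free_nilpotent d A)"
  unfolding free_nilpotent_def rees_quotient_def
  by (intro is_semigroup_quotient is_congruence_rees is_semigroup_free_semigroup
        is_ideal_long_words)

lemma carrier_free_nilpotent:
  "carrier (free_nilpotent d A) = word_class d A ` carrier (free_semigroup A)"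
  by (auto simp: free_nilpotent_def rees_quotient_def quotient_semigroup_def quotient_def
        word_class_def)

lemma word_class_mult:
  assumes "v \<in> carrier (free_semigroup A)" "w \<in> carrier (free_semigroup A)"
  shows "word_class d A v \<otimes>\<^bsub>free_nilpotent d A\<^esub> word_class d A w = word_class d A (v @ w)"
proof -
  have "is_congruence (free_semigroup A) (rees_congruence (free_semigroup A) (long_words d A))"
    by (intro is_congruence_rees is_semigroup_free_semigroup is_ideal_long_words)
  from quotient_mult[OF this assms] show ?thesis
    unfolding free_nilpotent_def rees_quotient_def word_class_def
    by (simp add: free_semigroup_def)
qed

lemma word_class_eq_iff:
  assumes "v \<in> carrier (free_semigroup A)" "w \<in> carrier (free_semigroup A)"
  shows "word_class d A v = word_class d A w \<longleftrightarrow> v = w \<or> d \<le> length v \<and> d \<le> length w"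
proof -
  have *: "word_class d A u = (if d \<le> length u then long_words d A else {u})"
    if "u \<in> carrier (free_semigroup A)" for u
    using that by (auto simp: word_class_def rees_congruence_def long_words_def)
  have "u \<in> long_words d A \<longleftrightarrow> d \<le> length u" if "u \<in> carrier (free_semigroup A)" for u
    using that by (simp add: long_words_def)
  then show ?thesis
    unfolding *[OF assms(1)] *[OF assms(2)]
    using assms by (smt (verit) singleton_iff)
qed

lemma theta_distinct:
  assumes "a \<noteq> b"
  shows "card (theta_class1 a b) = 2" "card (theta_class2 a b) = 2"
    "theta_class1 a b \<inter> theta_class2 a b = {}"
proof -
  have W: "{[a, b, a, b], [b, a, b, a], [a, a, b, b], [b, b, a, a]} \<subseteq> carrier (free_semigroup {a, b})"
    by (simp add: free_semigroup_def)
  have "inj_on (word_class 5 {a, b}) {[a, b, a, b], [b, a, b, a], [a, a, b, b], [b, b, a, a]}"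
  proof (rule inj_onI)
    fix v w
    assume *: "v \<in> {[a, b, a, b], [b, a, b, a], [a, a, b, b], [b, b, a, a]}"
      "w \<in> {[a, b, a, b], [b, a, b, a], [a, a, b, b], [b, b, a, a]}"
      "word_class 5 {a, b} v = word_class 5 {a, b} w"
    from *(1) have "length v = 4" by auto
    with *(3) show "v = w"
      using word_class_eq_iff[OF subsetD[OF W *(1)] subsetD[OF W *(2)], of 5] by simp
  qed
  with assms show "card (theta_class1 a b) = 2" "card (theta_class2 a b) = 2"
    "theta_class1 a b \<inter> theta_class2 a b = {}"
    by (simp_all add: theta_class1_def theta_class2_def)
qed

lemma is_congruence_theta:
  assumes "a \<noteq> b"
  shows "is_congruence (free_nilpotent 5 {a, b}) (theta a b)"
proof -
  let ?F = "free_nilpotent 5 {a, b}" and ?W = "carrier (free_semigroup {a, b})"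
  let ?c = "word_class 5 {a, b}"
  let ?C = "theta_class1 a b \<union> theta_class2 a b"
  have len4: "\<exists>w\<in>?W. x = ?c w \<and> length w = 4" if "x \<in> ?C" for x
  proof -
    have "?C = ?c ` {[a, b, a, b], [b, a, b, a], [a, a, b, b], [b, b, a, a]}"
      unfolding theta_class1_def theta_class2_def by (simp add: insert_commute)
    with that have "x \<in> ?c ` {[a, b, a, b], [b, a, b, a], [a, a, b, b], [b, b, a, a]}"
      by (simp only:)
    then obtain w where w: "x = ?c w" "w \<in> {[a, b, a, b], [b, a, b, a], [a, a, b, b], [b, b, a, a]}"
      by (rule imageE)
    from w(2) have "w \<in> ?W" "length w = 4"
      by (auto simp: free_semigroup_def)
    with w(1) show ?thesis by blast
  qed
  then have sub: "?C \<subseteq> carrier ?F"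
    by (auto simp: carrier_free_nilpotent)
  have zero: "?c w = ?c (replicate 5 a)" if "w \<in> ?W" "length w \<ge> 5" for w
    using that by (subst word_class_eq_iff) (auto simp: free_semigroup_def)
  have zl: "x \<otimes>\<^bsub>?F\<^esub> y = ?c (replicate 5 a)" and zr: "y \<otimes>\<^bsub>?F\<^esub> x = ?c (replicate 5 a)"
    if x: "x \<in> ?C" and y: "y \<in> carrier ?F" for x y
  proof -
    obtain v w where vw: "v \<in> ?W" "x = ?c v" "length v = 4" "w \<in> ?W" "y = ?c w"
      using len4[OF x] y by (auto simp: carrier_free_nilpotent)
    moreover from this have "w \<noteq> []" by (simp add: free_semigroup_def)
    then have "length w \<ge> 1" by (cases w) simp_all
    ultimately have "v @ w \<in> ?W" "w @ v \<in> ?W" "length (v @ w) \<ge> 5" "length (w @ v) \<ge> 5"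
      by (simp_all add: free_semigroup_def)
    then show "x \<otimes>\<^bsub>?F\<^esub> y = ?c (replicate 5 a)" "y \<otimes>\<^bsub>?F\<^esub> x = ?c (replicate 5 a)"
      using zero[of "v @ w"] zero[of "w @ v"] vw by (simp_all only: word_class_mult)
  qed
  have mem: "x \<in> carrier ?F \<and> y \<in> carrier ?F \<and> (x = y \<or> x \<in> ?C \<and> y \<in> ?C)"
    if "(x, y) \<in> theta a b" for x y
    using that sub by (auto simp: theta_def)
  have cl: "x \<otimes>\<^bsub>?F\<^esub> y \<in> carrier ?F" if "x \<in> carrier ?F" "y \<in> carrier ?F" for x y
    using that is_semigroup_free_nilpotent[of 5 "{a, b}"] by (auto simp: is_semigroup_def)
  have refl: "(x, x) \<in> theta a b" if "x \<in> carrier ?F" for x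
    using that by (auto simp: theta_def)
  have "equiv (carrier ?F) (theta a b)"
  proof (rule equivI)
    show "theta a b \<subseteq> carrier ?F \<times> carrier ?F" using mem by auto
    show "refl_on (carrier ?F) (theta a b)" using refl by (auto simp: refl_on_def)
    show "sym (theta a b)" by (rule symI) (auto simp: theta_def)
    have iff: "(x, y) \<in> theta a b \<longleftrightarrow> x \<in> theta_class1 a b \<and> y \<in> theta_class1 a b
        \<or> x \<in> theta_class2 a b \<and> y \<in> theta_class2 a b \<or> x = y \<and> x \<in> carrier ?F" for x y
      by (auto simp: theta_def)
    show "trans (theta a b)"
      using theta_distinct(3)[OF assms] by (intro transI) (unfold iff, blast)
  qed
  moreover have "(x \<otimes>\<^bsub>?F\<^esub> y, x' \<otimes>\<^bsub>?F\<^esub> y') \<in> theta a b"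
    if "(x, x') \<in> theta a b" "(y, y') \<in> theta a b" for x x' y y'
  proof -
    have "x \<otimes>\<^bsub>?F\<^esub> y = x' \<otimes>\<^bsub>?F\<^esub> y'"
      using mem[OF that(1)] mem[OF that(2)] zl zr by metis
    with mem[OF that(1)] mem[OF that(2)] show ?thesis
      by (simp add: refl cl)
  qed
  ultimately show ?thesis
    unfolding is_congruence_def by auto
qed

lemma theta_classes:
  assumes "a \<noteq> b"
  shows "carrier (free_nilpotent 5 {a, b}) // theta a b =
    {theta_class1 a b, theta_class2 a b} \<union>
    {{s} | s. s \<in> carrier (free_nilpotent 5 {a, b}) - theta_class1 a b - theta_class2 a b}"
    (is "?L = ?R")
proof -
  let ?C1 = "theta_class1 a b" and ?C2 = "theta_class2 a b"
  let ?F = "carrier (free_nilpotent 5 {a, b})"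
  have sub: "?C1 \<subseteq> ?F" "?C2 \<subseteq> ?F"
    by (auto simp: theta_class1_def theta_class2_def carrier_free_nilpotent free_semigroup_def)
  have 1: "theta a b `` {x} = ?C1" if "x \<in> ?C1" for x
    using that theta_distinct(3)[OF assms] by (auto simp: theta_def)
  have 2: "theta a b `` {x} = ?C2" if "x \<in> ?C2" for x
    using that theta_distinct(3)[OF assms] by (auto simp: theta_def)
  have 3: "theta a b `` {x} = {x}" if "x \<in> ?F - ?C1 - ?C2" for x
    using that by (auto simp: theta_def)
  have ne: "\<exists>x. x \<in> ?C1" "\<exists>x. x \<in> ?C2"
    by (auto simp: theta_class1_def theta_class2_def)
  have "?L = (\<lambda>x. theta a b `` {x}) ` (?C1 \<union> ?C2 \<union> (?F - ?C1 - ?C2))"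
    using sub by (auto simp: quotient_def)
  also have "\<dots> = ?R"
    unfolding image_Un using 1 2 3 ne by (auto simp: image_iff)
  finally show ?thesis .
qed

end

theory Submission
  imports Defs "HOL-Library.Multiset"
begin

text \<open>
  Write \<open>S\<close> for the monoid. Its elements are named by words over \<open>{a, b}\<close>: all words of length at
  least 5 name the zero, and apart from that only \<open>abab\<close>, \<open>baba\<close> and \<open>aabb\<close>, \<open>bbaa\<close> are
  identified. Consequently \<open>S\<close> satisfies \<open>xyxy = yxyx\<close> and \<open>xxyy = yyxx\<close>.

  Consider a term in which each of \<open>n\<close> variables occurs exactly twice, and picture every variable as
  the interval between its two occurrences. The term has a nonzero value only if the words
  substituted for the variables have total length at most 2, so at most two variables have a value
  other than 1. Hence the term function sees only pairs of variables; for a pair it distinguishes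
  crossing intervals (\<open>xyxy\<close> or \<open>yxyx\<close>) from disjoint ones (\<open>xxyy\<close> or \<open>yyxx\<close>) and from nested
  ones, but the order of the two variables in a crossing or disjoint pair is lost.

  Now prescribe the pairs cyclically: the variables \<open>p\<close> and \<open>p + 1\<close> modulo \<open>n\<close> cross, and all other
  pairs are disjoint. No term has this pattern when \<open>n \<ge> 4\<close>, because a cycle of length at least 4 is
  not an interval graph (\<open>no_word_with_cyclic_pattern\<close>). If one variable \<open>k\<close> is left out, the cycle
  becomes a path, and the pattern of a path is realized by a chain
  \<open>1 2 1 3 2 4 3 \<dots>\<close> of intervals (\<open>filter_cut_word\<close>). So there is a function \<open>cycle_fun\<close> on \<open>S\<close>
  that encodes the cyclic pattern: at a tuple with value 1 in position \<open>k\<close> it is the value of the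
  chain that omits \<open>k\<close>, followed by \<open>kk\<close>.

  This function is not a term function, but it agrees with one on all tuples with equal entries in two
  positions \<open>i \<noteq> j\<close> (\<open>cycle_fun_minor\<close>): if the common entry is 1, then the chain that omits \<open>i\<close> has
  the right value; otherwise the two entries already use up the total length 2, and only the number of
  occurrences matters. A function of large arity with this property preserves every relation of bounded
  size that is invariant under the terms (\<open>not_finitely_related_criterion\<close>), so finitely many relations
  cannot separate it from the term functions.
\<close>

section \<open>A pigeonhole criterion\<close>

text \<open>
  If \<open>f\<close> has more arguments than \<open>R\<close> has elements, then among any arguments taken from \<open>R\<close> two
  coincide. There \<open>f\<close> agrees with a term function, so it preserves \<open>R\<close> whenever all term functions do.
\<close>

lemma not_finitely_related_criterion:
  fixes S :: "('a, 'm) semigrp_scheme"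
  assumes fin: "finite (carrier S)"
    and ex: "\<And>N. \<exists>n\<ge>N. \<exists>f \<in> finitary_functions (carrier S) n. f \<notin> term_functions S n \<and>
      (\<forall>i<n. \<forall>j<n. i \<noteq> j \<longrightarrow>
        (\<exists>g \<in> term_functions S n. \<forall>x \<in> {..<n} \<rightarrow>\<^sub>E carrier S. x i = x j \<longrightarrow> f x = g x))"
  shows "\<not> finitely_related S"
proof
  assume "finitely_related S"
  then obtain \<R> where finR: "finite \<R>"
    and R': "\<forall>(k, R) \<in> \<R>. 1 \<le> k \<and> R \<subseteq> ({..<k} \<rightarrow>\<^sub>E carrier S)"
    and tf': "\<forall>n\<ge>1. term_functions S n =
           {f \<in> finitary_functions (carrier S) n. \<forall>(k, R) \<in> \<R>. preserves n f k R}"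
    unfolding finitely_related_def by (elim exE conjE)
  have R: "R \<subseteq> ({..<k} \<rightarrow>\<^sub>E carrier S)" if "(k, R) \<in> \<R>" for k R
    using bspec[OF R' that] by simp
  note tf = tf'[rule_format]
  define N where "N = Suc (\<Sum>(k, R)\<in>\<R>. card R)"
  obtain n f where n: "n \<ge> N" and f: "f \<in> finitary_functions (carrier S) n"
    and nt: "f \<notin> term_functions S n"
    and minor: "\<forall>i<n. \<forall>j<n. i \<noteq> j \<longrightarrow>
      (\<exists>g \<in> term_functions S n. \<forall>x \<in> {..<n} \<rightarrow>\<^sub>E carrier S. x i = x j \<longrightarrow> f x = g x)"
    using ex[of N] by (elim exE bexE conjE)
  have n1: "n \<ge> 1" using n by (simp add: N_def)
  have "preserves n f k R" if kR: "(k, R) \<in> \<R>" for k R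
    unfolding preserves_def
  proof (intro allI impI)
    fix r assume r: "\<forall>j<n. r j \<in> R"
    have "card R \<le> (\<Sum>(k, R)\<in>\<R>. card R)"
      using member_le_sum[of "(k, R)" \<R> "\<lambda>(k, R). card R"] finR kR by simp
    then have "card R < n" using n by (simp add: N_def)
    moreover have "finite R"
      by (rule finite_subset[OF R[OF kR]]) (intro finite_PiE finite_lessThan fin)
    ultimately have "\<not> inj_on r {..<n}"
      using card_inj_on_le[of r "{..<n}" R] r by (force simp: image_subset_iff)
    then obtain i j where ij: "i < n" "j < n" "i \<noteq> j" "r i = r j"
      by (auto simp: inj_on_def)
    obtain g where g: "g \<in> term_functions S n"
      and fg: "\<And>x. x \<in> {..<n} \<rightarrow>\<^sub>E carrier S \<Longrightarrow> x i = x j \<Longrightarrow> f x = g x"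
      using minor[rule_format, OF ij(1-3)] by blast
    have "(\<lambda>c\<in>{..<k}. f (\<lambda>j\<in>{..<n}. r j c)) = (\<lambda>c\<in>{..<k}. g (\<lambda>j\<in>{..<n}. r j c))"
    proof (rule restrict_ext)
      fix c assume c: "c \<in> {..<k}"
      show "f (\<lambda>j\<in>{..<n}. r j c) = g (\<lambda>j\<in>{..<n}. r j c)"
      proof (rule fg)
        have "r j c \<in> carrier S" if "j < n" for j
        proof -
          have "r j \<in> {..<k} \<rightarrow>\<^sub>E carrier S" using r that R[OF kR] by blast
          then show ?thesis using c by (rule PiE_mem)
        qed
        then show "(\<lambda>j\<in>{..<n}. r j c) \<in> {..<n} \<rightarrow>\<^sub>E carrier S" by auto
      qed (use ij in auto)
    qed
    moreover have "preserves n g k R"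
      using g kR unfolding tf[OF n1] by blast
    ultimately show "(\<lambda>c\<in>{..<k}. f (\<lambda>j\<in>{..<n}. r j c)) \<in> R"
      using r by (simp add: preserves_def)
  qed
  then have "f \<in> term_functions S n"
    using f unfolding tf[OF n1] by blast
  with nt show False by simp
qed

section \<open>Words over two letters as names of the elements\<close>

abbreviation nil_monoid :: "'a \<Rightarrow> 'a \<Rightarrow> 'a list set set option semigrp" where
  "nil_monoid a b \<equiv> adjoin_identity (quotient_semigroup (free_nilpotent 5 {a, b}) (theta a b))"

definition word_value :: "'a \<Rightarrow> 'a \<Rightarrow> 'a list \<Rightarrow> 'a list set set option" where
  "word_value a b w = (if w = [] then None else Some (theta a b `` {word_class 5 {a, b} w}))"

lemma word_value_Nil [simp]: "word_value a b [] = None"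
  by (simp add: word_value_def)

lemma word_value_eq_None_iff [simp]: "word_value a b w = None \<longleftrightarrow> w = []"
  by (simp add: word_value_def)

lemma free_carrier_iff: "w \<in> carrier (free_semigroup A) \<longleftrightarrow> w \<in> lists A \<and> w \<noteq> []"
  by (simp add: free_semigroup_def)

lemma word_value_append:
  assumes "a \<noteq> b" "v \<in> lists {a, b}" "w \<in> lists {a, b}"
  shows "word_value a b (v @ w) = word_value a b v \<otimes>\<^bsub>nil_monoid a b\<^esub> word_value a b w"
proof (cases "v = [] \<or> w = []")
  case True
  then show ?thesis
    by (auto simp: adjoin_identity_def word_value_def)
next
  case False
  then have vw: "v \<in> carrier (free_semigroup {a, b})" "w \<in> carrier (free_semigroup {a, b})"
    using assms by (simp_all add: free_carrier_iff)
  then have "word_class 5 {a, b} v \<in> carrier (free_nilpotent 5 {a, b})"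
    "word_class 5 {a, b} w \<in> carrier (free_nilpotent 5 {a, b})"
    by (simp_all add: carrier_free_nilpotent)
  from quotient_mult[OF is_congruence_theta[OF assms(1)] this] word_class_mult[OF vw, of 5]
  show ?thesis using False
    by (simp add: adjoin_identity_def word_value_def)
qed

lemma carrier_nil_monoid: "carrier (nil_monoid a b) = word_value a b ` lists {a, b}"
proof -
  have "carrier (quotient_semigroup (free_nilpotent 5 {a, b}) (theta a b))
      = (\<lambda>w. theta a b `` {word_class 5 {a, b} w}) ` carrier (free_semigroup {a, b})"
    by (auto simp: quotient_semigroup_def quotient_def carrier_free_nilpotent)
  moreover have "lists {a, b} = insert [] (carrier (free_semigroup {a, b}))"
    by (auto simp: free_carrier_iff)
  moreover have "word_value a b ` carrier (free_semigroup {a, b})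
      = Some ` (\<lambda>w. theta a b `` {word_class 5 {a, b} w}) ` carrier (free_semigroup {a, b})"
    unfolding image_image by (intro image_cong) (auto simp: word_value_def free_carrier_iff)
  ultimately show ?thesis
    by (simp add: adjoin_identity_def)
qed

lemma word_value_eq_iff:
  assumes "a \<noteq> b" "v \<in> lists {a, b}" "w \<in> lists {a, b}"
  shows "word_value a b v = word_value a b w \<longleftrightarrow>
    v = w \<or> 5 \<le> length v \<and> 5 \<le> length w
    \<or> v \<in> {[a, b, a, b], [b, a, b, a]} \<and> w \<in> {[a, b, a, b], [b, a, b, a]}
    \<or> v \<in> {[a, a, b, b], [b, b, a, a]} \<and> w \<in> {[a, a, b, b], [b, b, a, a]}"
proof (cases "v = [] \<or> w = []")
  case True
  then show ?thesis by (auto simp: word_value_def)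
next
  case False
  let ?c = "word_class 5 {a, b}"
  have vw: "v \<in> carrier (free_semigroup {a, b})" "w \<in> carrier (free_semigroup {a, b})"
    using assms False by (simp_all add: free_carrier_iff)
  then have cvw: "?c v \<in> carrier (free_nilpotent 5 {a, b})" "?c w \<in> carrier (free_nilpotent 5 {a, b})"
    by (simp_all add: carrier_free_nilpotent)
  have short: "?c x = ?c y \<longleftrightarrow> x = y"
    if "x \<in> carrier (free_semigroup {a, b})"
      "y \<in> {[a, b, a, b], [b, a, b, a], [a, a, b, b], [b, b, a, a]}" for x y
  proof -
    have "y \<in> carrier (free_semigroup {a, b})" "length y = 4"
      using that(2) by (auto simp: free_carrier_iff)
    then show ?thesis using word_class_eq_iff[OF that(1), of y 5] by simp
  qed
  have c1: "?c x \<in> theta_class1 a b \<longleftrightarrow> x \<in> {[a, b, a, b], [b, a, b, a]}"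
    and c2: "?c x \<in> theta_class2 a b \<longleftrightarrow> x \<in> {[a, a, b, b], [b, b, a, a]}"
    if "x \<in> carrier (free_semigroup {a, b})" for x
    using short[OF that] by (auto simp: theta_class1_def theta_class2_def)
  have "word_value a b v = word_value a b w \<longleftrightarrow> (?c v, ?c w) \<in> theta a b"
    using eq_equiv_class_iff[OF _ cvw] is_congruence_theta[OF assms(1)] False
    by (simp add: word_value_def is_congruence_def)
  also have "\<dots> \<longleftrightarrow> ?c v \<in> theta_class1 a b \<and> ?c w \<in> theta_class1 a b
      \<or> ?c v \<in> theta_class2 a b \<and> ?c w \<in> theta_class2 a b \<or> ?c v = ?c w"
    using cvw by (auto simp: theta_def)
  finally show ?thesis
    unfolding c1[OF vw(1)] c1[OF vw(2)] c2[OF vw(1)] c2[OF vw(2)] word_class_eq_iff[OF vw]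
    by blast
qed

lemma finite_carrier_nil_monoid:
  assumes "a \<noteq> b"
  shows "finite (carrier (nil_monoid a b))"
proof -
  have "word_value a b w \<in> word_value a b ` {w. set w \<subseteq> {a, b} \<and> length w \<le> 5}"
    if w: "w \<in> lists {a, b}" for w
  proof (cases "length w \<le> 5")
    case True
    with w show ?thesis by (auto simp: lists_eq_set)
  next
    case False
    then have "word_value a b w = word_value a b (replicate 5 a)"
      using w assms by (subst word_value_eq_iff) auto
    then show ?thesis by (auto intro!: image_eqI)
  qed
  then have "carrier (nil_monoid a b) \<subseteq> word_value a b ` {w. set w \<subseteq> {a, b} \<and> length w \<le> 5}"
    unfolding carrier_nil_monoid by blast
  then show ?thesis
    by (rule finite_subset) (intro finite_imageI finite_lists_length_le, simp)
qed

lemma word_value_long: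
  assumes "a \<noteq> b" "v \<in> lists {a, b}" "w \<in> lists {a, b}" "5 \<le> length v" "5 \<le> length w"
  shows "word_value a b v = word_value a b w"
  using assms by (subst word_value_eq_iff) auto

text \<open>
  The identities \<open>xyxy = yxyx\<close> and \<open>xxyy = yyxx\<close> of the monoid. For two different letters they
  are the definition of \<open>theta\<close>; they are trivial if \<open>x\<close> or \<open>y\<close> is 1, or if \<open>x = y\<close>; in all other cases
  both sides are zero.
\<close>

lemma word_value_swap:
  assumes "a \<noteq> b" "v \<in> lists {a, b}" "w \<in> lists {a, b}"
  shows "word_value a b (v @ w @ v @ w) = word_value a b (w @ v @ w @ v)"
    and "word_value a b (v @ v @ w @ w) = word_value a b (w @ w @ v @ v)"
proof -
  consider "v = [] \<or> w = []" | "length v + length w \<ge> 3" | "length v = 1" "length w = 1"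
    by (cases v; cases w) (auto simp: Suc_le_eq numeral_eq_Suc)
  then have "word_value a b (v @ w @ v @ w) = word_value a b (w @ v @ w @ v) \<and>
     word_value a b (v @ v @ w @ w) = word_value a b (w @ w @ v @ v)"
  proof cases
    case 1
    then show ?thesis by auto
  next
    case 2
    with assms show ?thesis by (intro conjI word_value_long) auto
  next
    case 3
    then obtain c d where cd: "v = [c]" "w = [d]"
      by (auto simp: length_Suc_conv)
    with assms have "c \<in> {a, b}" "d \<in> {a, b}" by auto
    with cd assms(1) show ?thesis
      by (subst (1 2) word_value_eq_iff) auto
  qed
  then show "word_value a b (v @ w @ v @ w) = word_value a b (w @ v @ w @ v)"
    and "word_value a b (v @ v @ w @ w) = word_value a b (w @ w @ v @ v)"
    by auto
qed

lemma concat_map_in_lists: "(\<And>i. i \<in> set t \<Longrightarrow> u i \<in> lists A) \<Longrightarrow> concat (map u t) \<in> lists A"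
  by (induction t) auto

lemma term_value_word_value:
  assumes "a \<noteq> b" "t \<noteq> []" "\<And>i. i \<in> set t \<Longrightarrow> u i \<in> lists {a, b} \<and> x i = word_value a b (u i)"
  shows "term_value (nil_monoid a b) x t = word_value a b (concat (map u t))"
  using assms(2,3)
proof (induction t rule: list_nonempty_induct)
  case (cons i t)
  have "concat (map u t) \<in> lists {a, b}"
    using cons.prems by (intro concat_map_in_lists) simp
  with cons show ?case
    using word_value_append[OF assms(1), of "u i" "concat (map u t)"] by (cases t) simp_all
qed simp

section \<open>Words in which consecutive variables alternate\<close>

text \<open>
  In \<open>chain_word [y1, y2, y3, y4] = [y1, y2, y1, y3, y2, y4, y3, y4]\<close> the interval of each variable is
  closed just after the next one has been opened. The recursion carries the variable \<open>y\<close> whose interval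
  is still open.
\<close>

fun chain_from :: "'v \<Rightarrow> 'v list \<Rightarrow> 'v list" where
  "chain_from y [] = [y]"
| "chain_from y (z # zs) = z # y # chain_from z zs"

fun chain_word :: "'v list \<Rightarrow> 'v list" where
  "chain_word [] = []"
| "chain_word (y # zs) = y # chain_from y zs"

lemma mset_chain_from: "mset (chain_from y zs) = {#y#} + mset zs + mset zs"
  by (induction zs arbitrary: y) auto

lemma mset_chain_word: "mset (chain_word ys) = mset ys + mset ys"
  by (cases ys) (auto simp: mset_chain_from)

lemma filter_chain_from_none:
  "p \<notin> set zs \<Longrightarrow> q \<notin> set zs \<Longrightarrow>
    filter (\<lambda>z. z = p \<or> z = q) (chain_from y zs) = (if y = p \<or> y = q then [y] else [])"
  by (induction zs arbitrary: y) auto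

lemma filter_chain_from_one:
  assumes "distinct zs" "q \<in> set zs" "p \<notin> set zs" "y \<noteq> p" "y \<notin> set zs"
  shows "filter (\<lambda>z. z = p \<or> z = q) (chain_from y zs) = [q, q]"
  using assms by (induction zs arbitrary: y) (auto simp: filter_chain_from_none)

lemma filter_chain_from_consecutive:
  assumes "distinct (y # us @ p # q # vs)"
  shows "filter (\<lambda>z. z = p \<or> z = q) (chain_from y (us @ p # q # vs)) = [p, q, p, q]"
  using assms by (induction us arbitrary: y) (auto simp: filter_chain_from_none)

lemma filter_chain_from_apart:
  assumes "distinct (y # us @ p # r # vs)" "q \<in> set vs"
  shows "filter (\<lambda>z. z = p \<or> z = q) (chain_from y (us @ p # r # vs)) = [p, p, q, q]"
  using assms by (induction us arbitrary: y) (auto simp: filter_chain_from_one)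

text \<open>Each interval is closed after the next one has been opened, but before the second next one is.\<close>

lemma filter_chain_word:
  assumes d: "distinct ys" and ij: "i < j" "j < length ys"
  shows "filter (\<lambda>z. z = ys ! i \<or> z = ys ! j) (chain_word ys) =
    (if j = Suc i then [ys ! i, ys ! j, ys ! i, ys ! j] else [ys ! i, ys ! i, ys ! j, ys ! j])"
proof -
  have split: "ys = take i ys @ ys ! i # ys ! Suc i # drop (Suc (Suc i)) ys"
    using ij by (simp add: Cons_nth_drop_Suc)
  obtain us p r vs where ys: "ys = us @ p # r # vs" "us = take i ys" "p = ys ! i" "r = ys ! Suc i"
      "vs = drop (Suc (Suc i)) ys"
    using split by blast
  have d': "distinct (us @ p # r # vs)" using d ys(1) by simp
  show ?thesis
  proof (cases "j = Suc i")
    case True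
    have "filter (\<lambda>z. z = p \<or> z = r) (chain_word (us @ p # r # vs)) = [p, r, p, r]"
      using d' filter_chain_from_consecutive[of "hd us" "tl us" p r vs]
      by (cases us) (auto simp: filter_chain_from_none)
    with True ys(3,4) show ?thesis unfolding ys(1)[symmetric] by simp
  next
    case False
    with ij obtain m where m: "j = Suc (Suc i) + m"
      using less_imp_Suc_add[of "Suc i" j] by auto
    with ij have "ys ! j = vs ! m" "m < length vs"
      by (simp_all add: ys(5))
    then have q: "ys ! j \<in> set vs" by simp
    have "filter (\<lambda>z. z = p \<or> z = ys ! j) (chain_word (us @ p # r # vs)) = [p, p, ys ! j, ys ! j]"
      using d' q filter_chain_from_apart[of "hd us" "tl us" p r vs "ys ! j"]
      by (cases us) (auto simp: filter_chain_from_one)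
    with False ys(3) show ?thesis unfolding ys(1)[symmetric] by simp
  qed
qed

section \<open>Cutting a cycle of variables\<close>

text \<open>
  The path that remains of the cycle \<open>0, 1, \<dots>, n - 1\<close> after the removal of \<open>k\<close>, traversed from
  \<open>k + 1\<close> to \<open>k - 1\<close>.
\<close>

definition cut_cycle :: "nat \<Rightarrow> nat \<Rightarrow> nat list" where
  "cut_cycle n k = map (\<lambda>m. (Suc k + m) mod n) [0..<n - 1]"

text \<open>
  The intervals of \<open>k\<close> and its two neighbours, which should cross, are disjoint here. Appending \<open>k\<close> twice
  makes every variable occur exactly twice, so that the length of the word after a substitution does not
  depend on \<open>k\<close>.
\<close>

definition cut_word :: "nat \<Rightarrow> nat \<Rightarrow> nat list" where
  "cut_word n k = chain_word (cut_cycle n k) @ [k, k]"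

definition cycle_adj :: "nat \<Rightarrow> nat \<Rightarrow> nat \<Rightarrow> bool" where
  "cycle_adj n p q \<longleftrightarrow> q = Suc p mod n \<or> p = Suc q mod n"

lemma shift_mod_eq_iff:
  fixes c i j n :: nat
  assumes "i < n" "j < n"
  shows "(c + i) mod n = (c + j) mod n \<longleftrightarrow> i = j"
proof -
  have *: "i = j" if "(c + i) mod n = (c + j) mod n" "i \<le> j" "j < n" for i j
  proof -
    have "n dvd (c + j) - (c + i)"
      using that(1,2) by (metis mod_eq_dvd_iff_nat add_left_mono)
    then have "n dvd j - i" by (metis add_diff_cancel_left)
    moreover have "j - i < n" using that(3) by linarith
    ultimately have "j - i = 0" using nat_dvd_not_less by blast
    with that(2) show "i = j" by linarith
  qed
  show ?thesis
    using assms *[of i j] *[of j i] by (metis linorder_le_cases)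
qed

lemma distinct_cut_cycle: "distinct (cut_cycle n k)"
proof -
  have "inj_on (\<lambda>m. (Suc k + m) mod n) {0..<n - 1}"
    by (rule inj_onI) (use shift_mod_eq_iff[of _ n _ "Suc k"] in simp)
  then show ?thesis
    by (simp add: cut_cycle_def distinct_map)
qed

lemma set_cut_cycle:
  assumes "k < n"
  shows "set (cut_cycle n k) = {..<n} - {k}"
proof (rule card_subset_eq)
  have "(Suc k + m) mod n \<noteq> k" if "m < n - 1" for m
    using shift_mod_eq_iff[of "Suc m" n 0 k] that assms by simp
  moreover have "set (cut_cycle n k) = (\<lambda>m. (Suc k + m) mod n) ` {..<n - 1}"
    by (simp add: cut_cycle_def lessThan_atLeast0)
  ultimately show "set (cut_cycle n k) \<subseteq> {..<n} - {k}"
    using assms by (auto simp del: add_Suc)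
  have "length (cut_cycle n k) = n - 1"
    by (simp add: cut_cycle_def)
  then show "card (set (cut_cycle n k)) = card ({..<n} - {k})"
    using assms distinct_card[OF distinct_cut_cycle, of n k] by simp
qed simp

lemma mset_cut_word:
  assumes "k < n"
  shows "mset (cut_word n k) = mset [0..<n] + mset [0..<n]"
proof -
  have "mset (k # cut_cycle n k) = mset [0..<n]"
  proof (rule set_eq_iff_mset_eq_distinct[THEN iffD1])
    show "set (k # cut_cycle n k) = set [0..<n]"
      unfolding list.set set_cut_cycle[OF assms] using assms by auto
  qed (simp_all add: distinct_cut_cycle set_cut_cycle[OF assms])
  moreover have "mset (cut_word n k) = mset (k # cut_cycle n k) + mset (k # cut_cycle n k)"
    by (simp add: cut_word_def mset_chain_word)
  ultimately show ?thesis by (simp only:)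
qed

lemma set_cut_word:
  assumes "k < n"
  shows "set (cut_word n k) = {..<n}"
proof -
  have "set (cut_word n k) = set ([0..<n] @ [0..<n])"
    by (rule mset_eq_setD) (simp only: mset_append mset_cut_word[OF assms])
  then show ?thesis
    by (simp add: lessThan_atLeast0)
qed

lemma cut_word_ne_Nil: "cut_word n k \<noteq> []"
  by (simp add: cut_word_def)

lemma length_concat_map_cut_word:
  assumes "k < n"
  shows "length (concat (map u (cut_word n k))) = 2 * (\<Sum>i<n. length (u i))"
proof -
  have "length (concat (map u (cut_word n k))) = (\<Sum>i\<in>#mset (cut_word n k). length (u i))"
    by (simp add: length_concat o_def flip: sum_mset_sum_list)
  also have "\<dots> = 2 * (\<Sum>i\<in>#mset [0..<n]. length (u i))"
    by (simp add: mset_cut_word[OF assms])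
  also have "(\<Sum>i\<in>#mset [0..<n]. length (u i)) = (\<Sum>i<n. length (u i))"
    by (simp add: sum_unfold_sum_mset lessThan_atLeast0)
  finally show ?thesis .
qed

lemma cycle_adj_sym: "cycle_adj n p q \<longleftrightarrow> cycle_adj n q p"
  by (auto simp: cycle_adj_def)

lemma cycle_adj_cut_cycle:
  assumes "i < j" "j < n - 1"
  shows "cycle_adj n (cut_cycle n k ! i) (cut_cycle n k ! j) \<longleftrightarrow> j = Suc i"
proof -
  have "Suc ((Suc k + m) mod n) mod n = (Suc k + Suc m) mod n" for m
    by (simp add: mod_Suc_eq)
  with assms show ?thesis
    by (simp add: cycle_adj_def cut_cycle_def shift_mod_eq_iff del: add_Suc add_Suc_right)
qed

text \<open>
  The words in which the intervals of \<open>p\<close> and \<open>q\<close> cross, respectively are disjoint. The monoid does not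
  distinguish the two members of either set (\<open>word_value_swap\<close>).
\<close>

definition pair_patterns :: "bool \<Rightarrow> 'v \<Rightarrow> 'v \<Rightarrow> 'v list set" where
  "pair_patterns alternating p q =
    (if alternating then {[p, q, p, q], [q, p, q, p]} else {[p, p, q, q], [q, q, p, p]})"

lemma filter_cut_word:
  assumes "k < n" "p < n" "q < n" "p \<noteq> q" "p \<noteq> k" "q \<noteq> k"
  shows "filter (\<lambda>z. z = p \<or> z = q) (cut_word n k) \<in> pair_patterns (cycle_adj n p q) p q"
proof -
  have *: "filter (\<lambda>z. z = p \<or> z = q) (cut_word n k) \<in> pair_patterns (cycle_adj n p q) p q"
    if ij: "i < j" "j < n - 1" and pq: "p = cut_cycle n k ! i" "q = cut_cycle n k ! j"
      "p \<noteq> k" "q \<noteq> k" for i j p q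
  proof -
    have "filter (\<lambda>z. z = p \<or> z = q) (cut_word n k)
        = filter (\<lambda>z. z = p \<or> z = q) (chain_word (cut_cycle n k))"
      using pq(3,4) by (simp add: cut_word_def)
    also have "\<dots> = (if cycle_adj n p q then [p, q, p, q] else [p, p, q, q])"
      unfolding pq(1,2) cycle_adj_cut_cycle[OF ij]
      using ij by (intro filter_chain_word distinct_cut_cycle) (simp_all add: cut_cycle_def)
    finally show ?thesis by (simp add: pair_patterns_def)
  qed
  have len: "length (cut_cycle n k) = n - 1" by (simp add: cut_cycle_def)
  have "p \<in> set (cut_cycle n k)" "q \<in> set (cut_cycle n k)"
    using assms set_cut_cycle by auto
  then obtain i j where ij: "i < n - 1" "cut_cycle n k ! i = p" "j < n - 1" "cut_cycle n k ! j = q"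
    unfolding in_set_conv_nth len by blast
  then consider "i < j" | "j < i" using assms(4) by (metis linorder_neqE_nat)
  then show ?thesis
  proof cases
    case 1
    show ?thesis
      by (rule *[OF 1 ij(3) ij(2)[symmetric] ij(4)[symmetric] assms(5,6)])
  next
    case 2
    have "filter (\<lambda>z. z = q \<or> z = p) (cut_word n k) \<in> pair_patterns (cycle_adj n q p) q p"
      by (rule *[OF 2 ij(1) ij(4)[symmetric] ij(2)[symmetric] assms(6,5)])
    then show ?thesis
      by (cases "cycle_adj n p q")
        (simp_all add: pair_patterns_def cycle_adj_sym[of n q p] disj_commute insert_commute)
  qed
qed

lemma filter_eq_single: "distinct xs \<Longrightarrow> y \<in> set xs \<Longrightarrow> filter (\<lambda>z. z = y) xs = [y]"
  by (induction xs) (auto simp: filter_empty_conv)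

text \<open>
  Let \<open>i\<close> be the variable whose interval closes first. The intervals of its two neighbours on the cycle
  cross that of \<open>i\<close> and close later, so both are open when \<open>i\<close> closes. Hence they meet, although the
  neighbours are not adjacent when \<open>n \<ge> 4\<close>.
\<close>

lemma no_word_with_cyclic_pattern:
  assumes n: "4 \<le> n" and t: "set t \<subseteq> {..<n}"
    and pat: "\<And>p q. p < n \<Longrightarrow> q < n \<Longrightarrow> p \<noteq> q \<Longrightarrow>
      filter (\<lambda>z. z = p \<or> z = q) t \<in> pair_patterns (cycle_adj n p q) p q"
  shows False
proof -
  have "\<not> distinct (filter (\<lambda>z. z = 0 \<or> z = 1) t)"
    using pat[of 0 1] n by (auto simp: pair_patterns_def split: if_splits)
  then have "\<not> distinct t"
    using distinct_filter by blast
  \<comment> \<open>The shortest prefix of \<open>t\<close> with a repeated variable is \<open>us @ [i]\<close>.\<close>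
  then obtain us i vs where i: "i \<in> set us" and us: "distinct us" and tu: "t = us @ i # vs"
    using not_distinct_conv_prefix[of t] by auto
  have "i < n" using t tu by auto
  have nb: "p \<in> set us" if p: "p < n" "p \<noteq> i" "cycle_adj n i p" for p
  proof (rule ccontr)
    assume "p \<notin> set us"
    then have "filter (\<lambda>z. z = i \<or> z = p) us = filter (\<lambda>z. z = i) us"
      by (auto intro!: filter_cong)
    also have "\<dots> = [i]" using us i by (rule filter_eq_single)
    finally show False
      using pat[OF \<open>i < n\<close> p(1)] p tu by (auto simp: pair_patterns_def)
  qed
  define p where "p = (if i = 0 then n - 1 else i - 1)"
  define q where "q = (if i = n - 1 then 0 else Suc i)"
  have pq: "p < n" "q < n" "p \<noteq> i" "q \<noteq> i" "p \<noteq> q"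
    using n \<open>i < n\<close> by (auto simp: p_def q_def)
  have adj: "cycle_adj n i p" "cycle_adj n i q" "\<not> cycle_adj n p q"
    using n \<open>i < n\<close> by (auto simp: p_def q_def cycle_adj_def mod_Suc)
  let ?xs = "filter (\<lambda>z. z = p \<or> z = q) us"
  have "distinct ?xs" "p \<in> set ?xs" "q \<in> set ?xs"
    using us nb pq adj by auto
  moreover have "?xs @ filter (\<lambda>z. z = p \<or> z = q) (i # vs) \<in> {[p, p, q, q], [q, q, p, p]}"
    using pat[of p q] pq adj tu by (simp add: pair_patterns_def)
  ultimately show False
    using pq(5) by (cases ?xs; cases "tl ?xs") auto
qed

section \<open>The cycle function\<close>

lemma concat_map_filter_support:
  "(\<And>z. z \<in> set t \<Longrightarrow> \<not> P z \<Longrightarrow> u z = []) \<Longrightarrow> concat (map u t) = concat (map u (filter P t))"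
  by (induction t) auto

lemma word_value_pair_pattern_cong:
  assumes "a \<noteq> b" "u p \<in> lists {a, b}" "u q \<in> lists {a, b}"
    and "s \<in> pair_patterns c p q" "t \<in> pair_patterns c p q"
  shows "word_value a b (concat (map u s)) = word_value a b (concat (map u t))"
  using assms(4,5) word_value_swap[OF assms(1-3)]
  by (auto simp: pair_patterns_def split: if_splits)

text \<open>
  The cyclic pattern determines the value wherever it is used: with at most two values other than 1, both
  words reduce to the same pattern of a pair that avoids \<open>k\<close> and \<open>l\<close>; with three or more, every variable
  occurring twice makes the length at least 6, and both values are zero.
\<close>

lemma cut_word_value_agree:
  assumes ab: "a \<noteq> b" and n: "4 \<le> n" and kl: "k < n" "l < n" "u k = []" "u l = []"
    and u: "\<And>i. i < n \<Longrightarrow> u i \<in> lists {a, b}"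
  shows "word_value a b (concat (map u (cut_word n k))) =
    word_value a b (concat (map u (cut_word n l)))"
proof -
  define supp where "supp = {i \<in> {..<n}. u i \<noteq> []}"
  show ?thesis
  proof (cases "card supp \<le> 2")
    case True
    \<comment> \<open>The support may have fewer than two elements; it is enlarged to a pair, for which \<open>n \<ge> 4\<close>
      leaves room besides \<open>k\<close> and \<open>l\<close>.\<close>
    have "supp \<subseteq> {..<n} - {k, l}" using kl by (auto simp: supp_def)
    moreover have "2 \<le> card ({..<n} - {k, l})"
      using n diff_card_le_card_Diff[of "{k, l}" "{..<n}"] card_insert_le_m1[of 2 "{l}" k] by simp
    ultimately obtain A where A: "supp \<subseteq> A" "A \<subseteq> {..<n} - {k, l}" "card A = 2"
      using exists_subset_between[of supp 2 "{..<n} - {k, l}"] True by auto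
    then obtain p q where pq: "A = {p, q}" "p \<noteq> q" by (meson card_2_iff)
    have red: "concat (map u (cut_word n m)) =
        concat (map u (filter (\<lambda>z. z = p \<or> z = q) (cut_word n m)))" if "m < n" for m
      using A(1) pq that by (intro concat_map_filter_support) (auto simp: supp_def set_cut_word)
    show ?thesis
      unfolding red[OF kl(1)] red[OF kl(2)]
      by (rule word_value_pair_pattern_cong[OF ab, where p = p and q = q])
        (use A pq kl u in \<open>auto intro!: filter_cut_word\<close>)
  next
    case False
    have "card supp = (\<Sum>i\<in>supp. 1)" by simp
    also have "\<dots> \<le> (\<Sum>i\<in>supp. length (u i))"
      by (intro sum_mono) (auto simp: supp_def Suc_le_eq)
    also have "\<dots> \<le> (\<Sum>i<n. length (u i))"
      by (intro sum_mono2) (auto simp: supp_def)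
    finally have "3 \<le> (\<Sum>i<n. length (u i))" using False by simp
    then show ?thesis using kl u
      by (intro word_value_long[OF ab] concat_map_in_lists)
        (auto simp: set_cut_word length_concat_map_cut_word simp del: length_concat)
  qed
qed

lemma replicate_lengthI: "set w \<subseteq> {c} \<Longrightarrow> w = replicate (length w) c"
  by (induction w) auto

text \<open>
  Two variables with a common value other than 1 contribute length at least 4. If they contribute more,
  or if a further variable contributes, then the values are zero; otherwise both values are the fourth
  power of one letter.
\<close>

lemma cut_word_value_collapse:
  assumes ab: "a \<noteq> b" and kl: "k < n" "l < n" and ij: "i < n" "j < n" "i \<noteq> j" "u i = u j" "u i \<noteq> []"
    and u: "\<And>i. i < n \<Longrightarrow> u i \<in> lists {a, b}"
  shows "word_value a b (concat (map u (cut_word n k))) =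
    word_value a b (concat (map u (cut_word n l)))"
proof (cases "3 \<le> (\<Sum>i<n. length (u i))")
  case True
  then show ?thesis using kl u
    by (intro word_value_long[OF ab] concat_map_in_lists)
      (auto simp: set_cut_word length_concat_map_cut_word simp del: length_concat)
next
  case False
  have "(\<Sum>m<n. length (u m)) = length (u i) + length (u j) + (\<Sum>m\<in>{..<n} - {i} - {j}. length (u m))"
    using ij by (simp add: sum.remove[of _ i] sum.remove[of _ j])
  moreover have "length (u i) \<ge> 1" "length (u j) \<ge> 1"
    using ij by (auto simp: Suc_le_eq)
  ultimately have 1: "length (u i) = 1" and 0: "(\<Sum>m\<in>{..<n} - {i} - {j}. length (u m)) = 0"
    using False by linarith+
  obtain c where c: "u i = [c]" using 1 by (auto simp: length_Suc_conv)
  have "set (u m) \<subseteq> {c}" if "m < n" for m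
    using 0 c ij that by (cases "m = i \<or> m = j") auto
  then have "set (concat (map u (cut_word n m))) \<subseteq> {c}" if "m < n" for m
    using that by (fastforce simp: set_cut_word)
  from replicate_lengthI[OF this[OF kl(1)]] replicate_lengthI[OF this[OF kl(2)]] show ?thesis
    by (metis kl length_concat_map_cut_word)
qed

text \<open>
  Any position of a 1 would serve (\<open>cycle_fun_eq\<close>). Without a 1 and with at least three positions,
  the total length exceeds 2, so every cut word has the value zero, and the default position is harmless.
\<close>

definition cut_index :: "nat \<Rightarrow> (nat \<Rightarrow> 'b option) \<Rightarrow> nat" where
  "cut_index n x = (if \<exists>k<n. x k = None then SOME k. k < n \<and> x k = None else 0)"

lemma cut_index_less: "0 < n \<Longrightarrow> cut_index n x < n"
  using someI_ex[of "\<lambda>k. k < n \<and> x k = None"] by (simp add: cut_index_def)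

lemma cut_index_None: "k < n \<Longrightarrow> x k = None \<Longrightarrow> x (cut_index n x) = None"
  using someI[of "\<lambda>k. k < n \<and> x k = None" k] by (auto simp: cut_index_def)

definition cycle_fun :: "'a \<Rightarrow> 'a \<Rightarrow> nat \<Rightarrow> (nat \<Rightarrow> 'a list set set option) \<Rightarrow> 'a list set set option" where
  "cycle_fun a b n = (\<lambda>x \<in> {..<n} \<rightarrow>\<^sub>E carrier (nil_monoid a b).
    term_value (nil_monoid a b) x (cut_word n (cut_index n x)))"

text \<open>
  Names are chosen by a function of the element, so that equal entries of a tuple get equal names.
\<close>

definition representing_word :: "'a \<Rightarrow> 'a \<Rightarrow> 'a list set set option \<Rightarrow> 'a list" where
  "representing_word a b = inv_into (lists {a, b}) (word_value a b)"

lemma representing_word: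
  assumes "x \<in> {..<n} \<rightarrow>\<^sub>E carrier (nil_monoid a b)" "i < n"
  shows "representing_word a b (x i) \<in> lists {a, b} \<and> x i = word_value a b (representing_word a b (x i))"
proof -
  have "x i \<in> word_value a b ` lists {a, b}"
    using PiE_mem[OF assms(1), of i] assms(2) unfolding carrier_nil_monoid by simp
  then show ?thesis
    unfolding representing_word_def by (simp only: f_inv_into_f inv_into_into simp_thms)
qed

lemma term_value_cut_word:
  assumes "a \<noteq> b" "k < n" "\<And>i. i < n \<Longrightarrow> u i \<in> lists {a, b} \<and> x i = word_value a b (u i)"
  shows "term_value (nil_monoid a b) x (cut_word n k) = word_value a b (concat (map u (cut_word n k)))"
  using assms by (intro term_value_word_value cut_word_ne_Nil) (auto simp: set_cut_word)

lemma cycle_fun_eq: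
  assumes ab: "a \<noteq> b" and n: "4 \<le> n" and x: "x \<in> {..<n} \<rightarrow>\<^sub>E carrier (nil_monoid a b)"
    and k: "k < n" "x k = None"
  shows "cycle_fun a b n x = term_value (nil_monoid a b) x (cut_word n k)"
proof -
  define u where "u i = representing_word a b (x i)" for i
  have u: "u i \<in> lists {a, b} \<and> x i = word_value a b (u i)" if "i < n" for i
    unfolding u_def by (rule representing_word[OF x that])
  define l where "l = cut_index n x"
  have l: "l < n" "x l = None"
    using n cut_index_less[of n x] cut_index_None[of k n x] k by (simp_all add: l_def)
  have "cycle_fun a b n x = term_value (nil_monoid a b) x (cut_word n l)"
    unfolding cycle_fun_def l_def using x by (rule restrict_apply')
  also have "\<dots> = word_value a b (concat (map u (cut_word n l)))"
    using u by (rule term_value_cut_word[OF ab l(1)])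
  also have "\<dots> = word_value a b (concat (map u (cut_word n k)))"
  proof (rule cut_word_value_agree[OF ab n l(1) k(1)])
    show "u l = []" using u[OF l(1)] l(2) by (metis word_value_eq_None_iff)
    show "u k = []" using u[OF k(1)] k(2) by (metis word_value_eq_None_iff)
  qed (simp add: u)
  also have "\<dots> = term_value (nil_monoid a b) x (cut_word n k)"
    using u by (rule term_value_cut_word[OF ab k(1), symmetric])
  finally show ?thesis .
qed

lemma cycle_fun_minor:
  assumes ab: "a \<noteq> b" and n: "4 \<le> n" and x: "x \<in> {..<n} \<rightarrow>\<^sub>E carrier (nil_monoid a b)"
    and ij: "i < n" "j < n" "i \<noteq> j" "x i = x j"
  shows "cycle_fun a b n x = term_value (nil_monoid a b) x (cut_word n i)"
proof (cases "x i = None")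
  case True
  then show ?thesis by (rule cycle_fun_eq[OF ab n x ij(1)])
next
  case False
  define u where "u i = representing_word a b (x i)" for i
  have u: "u i \<in> lists {a, b} \<and> x i = word_value a b (u i)" if "i < n" for i
    unfolding u_def by (rule representing_word[OF x that])
  have uij: "u i = u j"
    by (simp add: u_def ij(4))
  define l where "l = cut_index n x"
  have l: "l < n" using n by (simp add: l_def cut_index_less)
  have "cycle_fun a b n x = term_value (nil_monoid a b) x (cut_word n l)"
    unfolding cycle_fun_def l_def using x by (rule restrict_apply')
  also have "\<dots> = word_value a b (concat (map u (cut_word n l)))"
    using u by (rule term_value_cut_word[OF ab l(1)])
  also have "\<dots> = word_value a b (concat (map u (cut_word n i)))"
  proof (rule cut_word_value_collapse[OF ab l ij(1) ij(1-3) uij])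
    show "u i \<noteq> []" using u[OF ij(1)] False by (metis word_value_eq_None_iff)
  qed (simp add: u)
  also have "\<dots> = term_value (nil_monoid a b) x (cut_word n i)"
    using u by (rule term_value_cut_word[OF ab ij(1), symmetric])
  finally show ?thesis .
qed

lemma cycle_fun_finitary:
  assumes ab: "a \<noteq> b" and n: "4 \<le> n"
  shows "cycle_fun a b n \<in> finitary_functions (carrier (nil_monoid a b)) n"
proof -
  have "term_value (nil_monoid a b) x (cut_word n k) \<in> carrier (nil_monoid a b)"
    if x: "x \<in> {..<n} \<rightarrow>\<^sub>E carrier (nil_monoid a b)" and k: "k < n" for x k
  proof -
    define u where "u i = representing_word a b (x i)" for i
    have u: "u i \<in> lists {a, b} \<and> x i = word_value a b (u i)" if "i < n" for i
      unfolding u_def by (rule representing_word[OF x that])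
    have "concat (map u (cut_word n k)) \<in> lists {a, b}"
      using u k by (intro concat_map_in_lists) (auto simp: set_cut_word)
    moreover have "term_value (nil_monoid a b) x (cut_word n k) =
        word_value a b (concat (map u (cut_word n k)))"
      using u by (rule term_value_cut_word[OF ab k])
    ultimately show ?thesis
      unfolding carrier_nil_monoid by (simp only: imageI)
  qed
  moreover have "cut_index n x < n" for x :: "nat \<Rightarrow> 'a list set set option"
    using n by (simp add: cut_index_less)
  ultimately show ?thesis
    unfolding finitary_functions_def cycle_fun_def by (intro restrict_PiE_iff[THEN iffD2] ballI) simp
qed

text \<open>
  Substituting \<open>a\<close> for \<open>p\<close>, \<open>b\<close> for \<open>q\<close> and 1 for the other variables shows the pattern of the pair in
  any term that represents the function, which would therefore have the cyclic pattern.
\<close>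

lemma cycle_fun_not_term:
  assumes ab: "a \<noteq> b" and n: "4 \<le> n"
  shows "cycle_fun a b n \<notin> term_functions (nil_monoid a b) n"
proof
  assume "cycle_fun a b n \<in> term_functions (nil_monoid a b) n"
  then obtain t where f_eq: "cycle_fun a b n =
      (\<lambda>x \<in> {..<n} \<rightarrow>\<^sub>E carrier (nil_monoid a b). term_value (nil_monoid a b) x t)"
    and "t \<in> carrier (free_semigroup {..<n})"
    unfolding term_functions_def by (elim CollectE exE conjE)
  then have t: "set t \<subseteq> {..<n}" "t \<noteq> []"
    by (simp_all add: free_carrier_iff in_lists_conv_set subset_iff)
  have ft: "cycle_fun a b n x = term_value (nil_monoid a b) x t"
    if "x \<in> {..<n} \<rightarrow>\<^sub>E carrier (nil_monoid a b)" for x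
    unfolding f_eq using that by (rule restrict_apply')
  have "filter (\<lambda>z. z = p \<or> z = q) t \<in> pair_patterns (cycle_adj n p q) p q"
    if pq: "p < n" "q < n" "p \<noteq> q" for p q
  proof -
    define u where "u i = (if i = p then [a] else if i = q then [b] else [])" for i
    define x where "x = (\<lambda>i\<in>{..<n}. word_value a b (u i))"
    define h where "h i = (if i = p then a else b)" for i
    let ?P = "\<lambda>z. z = p \<or> z = q"
    have ul: "u i \<in> lists {a, b}" for i by (simp add: u_def)
    have ux: "u i \<in> lists {a, b} \<and> x i = word_value a b (u i)" if "i < n" for i
      using that ul by (simp add: x_def)
    have x: "x \<in> {..<n} \<rightarrow>\<^sub>E carrier (nil_monoid a b)"
      unfolding carrier_nil_monoid x_def using ul by auto
    have cm: "concat (map u s) = map h (filter ?P s)" for s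
      using pq(3) by (induction s) (auto simp: u_def h_def)
    \<comment> \<open>A third position, where the tuple has a 1, names a cut word that represents the function at \<open>x\<close>.\<close>
    have "card {p, q} < card {..<n}" using n pq by simp
    then obtain k where k: "k < n" "k \<noteq> p" "k \<noteq> q"
      using card_mono[of "{p, q}" "{..<n}"] by force
    have "word_value a b (concat (map u t)) = term_value (nil_monoid a b) x t"
      using t ux by (intro term_value_word_value[symmetric] ab) auto
    also have "\<dots> = term_value (nil_monoid a b) x (cut_word n k)"
      using ft[OF x] cycle_fun_eq[OF ab n x k(1)] k ux[OF k(1)] by (simp add: u_def)
    also have "\<dots> = word_value a b (concat (map u (cut_word n k)))"
      using k ux by (intro term_value_cut_word ab) auto
    finally have eq: "word_value a b (map h (filter ?P t)) =
        word_value a b (map h (filter ?P (cut_word n k)))"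
      by (simp add: cm)
    have ls: "map h w \<in> lists {a, b}" for w by (auto simp: h_def)
    have "map h (filter ?P (cut_word n k)) \<in> pair_patterns (cycle_adj n p q) a b"
      using filter_cut_word[of k n p q] k pq by (auto simp: pair_patterns_def h_def split: if_splits)
    then have "map h (filter ?P t) \<in> pair_patterns (cycle_adj n p q) a b"
      using eq unfolding word_value_eq_iff[OF ab ls ls]
      by (auto simp: pair_patterns_def split: if_splits)
    \<comment> \<open>\<open>h\<close> is injective on \<open>{p, q}\<close>; this map inverts it.\<close>
    then have "map (\<lambda>c. if c = a then p else q) (map h (filter ?P t)) \<in> pair_patterns (cycle_adj n p q) p q"
      using ab by (auto simp: pair_patterns_def split: if_splits)
    moreover have "map (\<lambda>c. if c = a then p else q) (map h (filter ?P t)) = filter ?P t"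
      using ab by (induction t) (auto simp: h_def)
    ultimately show ?thesis by simp
  qed
  with no_word_with_cyclic_pattern[OF n t(1)] show False by blast
qed

theorem theorem2p5:
  fixes a b :: 'a
  assumes "a \<noteq> b"
  shows "\<not> finitely_related
    (adjoin_identity (quotient_semigroup (free_nilpotent 5 {a, b}) (theta a b)))"
proof (rule not_finitely_related_criterion)
  show "finite (carrier (nil_monoid a b))"
    using assms by (rule finite_carrier_nil_monoid)
next
  fix N :: nat
  define n where "n = max N 4"
  have n: "4 \<le> n" "N \<le> n" by (simp_all add: n_def)
  have "\<exists>g \<in> term_functions (nil_monoid a b) n. \<forall>x \<in> {..<n} \<rightarrow>\<^sub>E carrier (nil_monoid a b).
      x i = x j \<longrightarrow> cycle_fun a b n x = g x"
    if ij: "i < n" "j < n" "i \<noteq> j" for i j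
  proof
    let ?g = "\<lambda>x \<in> {..<n} \<rightarrow>\<^sub>E carrier (nil_monoid a b). term_value (nil_monoid a b) x (cut_word n i)"
    have "cut_word n i \<in> carrier (free_semigroup {..<n})"
      using set_cut_word[OF ij(1)] cut_word_ne_Nil[of n i] by (auto simp: free_carrier_iff)
    then show "?g \<in> term_functions (nil_monoid a b) n"
      unfolding term_functions_def by (intro CollectI exI[of _ "cut_word n i"] conjI refl)
    show "\<forall>x \<in> {..<n} \<rightarrow>\<^sub>E carrier (nil_monoid a b). x i = x j \<longrightarrow> cycle_fun a b n x = ?g x"
    proof (intro ballI impI)
      fix x assume x: "x \<in> {..<n} \<rightarrow>\<^sub>E carrier (nil_monoid a b)" "x i = x j"
      show "cycle_fun a b n x = ?g x"
        unfolding restrict_apply'[OF x(1)] by (rule cycle_fun_minor[OF assms n(1) x(1) ij x(2)])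
    qed
  qed
  then have minors: "\<forall>i<n. \<forall>j<n. i \<noteq> j \<longrightarrow> (\<exists>g \<in> term_functions (nil_monoid a b) n.
      \<forall>x \<in> {..<n} \<rightarrow>\<^sub>E carrier (nil_monoid a b). x i = x j \<longrightarrow> cycle_fun a b n x = g x)"
    by (intro allI impI)
  show "\<exists>n\<ge>N. \<exists>f \<in> finitary_functions (carrier (nil_monoid a b)) n.
      f \<notin> term_functions (nil_monoid a b) n \<and>
      (\<forall>i<n. \<forall>j<n. i \<noteq> j \<longrightarrow> (\<exists>g \<in> term_functions (nil_monoid a b) n.
        \<forall>x \<in> {..<n} \<rightarrow>\<^sub>E carrier (nil_monoid a b). x i = x j \<longrightarrow> f x = g x))"
    by (intro exI[of _ n] conjI bexI[of _ "cycle_fun a b n"] n minors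
        cycle_fun_finitary[OF assms n(1)] cycle_fun_not_term[OF assms n(1)])
qed

end
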